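(* Let $p$ be an odd prime, $b\in\mathbb Z_p$ with $\langle b\rangle_p>p/2$, and let $s=(b-\langle b\rangle_p)/p$ with $s\not\equiv-1\pmod p$. Then, modulo $p^2$, $$\sum_{k=0}^{p-1}\frac{\binom{2k}k^2}{16^k}\cdot\frac p{k+b}\equiv\sum_{k=0}^{(p-1)/2}\frac{\binom{2k}k^2}{16^k}\cdot\frac p{k+b}\equiv\frac{\binom{2(\langle b\rangle_p-\frac{p+1}2)}{\langle b\rangle_p-\frac{p+1}2}^2}{(s+1)16^{\langle b\rangle_p-\frac{p+1}2}}\Big(1+p(2s+1)\big(H_{p-\langle b\rangle_p}-H_{\langle b\rangle_p-\frac{p+1}2}\big)\Big)$$ $$\equiv\frac1{s+1}\binom{\frac{p-1}2}{p-\langle b\rangle_p}^2\Big(1+p\big(2q_p(2)+(2s+2)H_{p-\langle b\rangle_p}-(2s+1)H_{\langle b\rangle_p-\frac{p+1}2}\big)\Big)\equiv\frac{\binom{2(p-\langle b\rangle_p)}{p-\langle b\rangle_p}^2}{(s+1)16^{p-\langle b\rangle_p}}\Big(1+p(2s+2)\big(H_{p-\langle b\rangle_p}-H_{\langle b\rangle_p-\frac{p+1}2}\big)\Big).$$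
   Context: $\mathbb Z_p$ denotes the set of rational numbers whose denominator is not divisible by $p$; congruences are taken in this ring. For $b\in\mathbb Z_p$, $\langle b\rangle_p\in\{0,1,\dots,p-1\}$ is defined by $b\equiv\langle b\rangle_p\pmod p$. $q_p(2)=(2^{p-1}-1)/p$. $H_0=0$, $H_n=1+\frac12+\cdots+\frac1n$. *)

theory Defs
  imports Complex_Main "HOL-Number_Theory.Cong"
begin

definition p_integral :: "nat \<Rightarrow> rat set" where
  "p_integral p = {x. \<not> int p dvd snd (quotient_of x)}"

(* Congruence in the ring of p-integral rationals: both sides are required to be p-integral,
   and m divides their difference inside that ring. *)
definition p_cong :: "nat \<Rightarrow> rat \<Rightarrow> rat \<Rightarrow> rat \<Rightarrow> bool" where
  "p_cong p m x y \<longleftrightarrow>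
     x \<in> p_integral p \<and> y \<in> p_integral p \<and> (\<exists>c \<in> p_integral p. x - y = m * c)"

(* Meaningful for prime p and p-integral b only; see least_residue_unique below. *)
definition least_residue :: "nat \<Rightarrow> rat \<Rightarrow> nat" where
  "least_residue p b = (THE r. r < p \<and> p_cong p (of_nat p) b (of_nat r))"

(* The library's harm lives in class real_normed_field, which excludes the type rat. *)
definition harm_rat :: "nat \<Rightarrow> rat" where
  "harm_rat n = (\<Sum>k=1..n. 1 / of_nat k)"

definition fermat_quotient_2 :: "nat \<Rightarrow> rat" where
  "fermat_quotient_2 p = (2 ^ (p - 1) - 1) / of_nat p"

lemma p_integralI:
  assumes "x = of_int a / of_int d" and "\<not> int p dvd d"
  shows "x \<in> p_integral p"
proof -
  obtain n e where q: "quotient_of x = (n, e)" by force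
  have e: "e > 0" and cop: "coprime n e" and x: "x = of_int n / of_int e"
    using quotient_of_denom_pos[OF q] quotient_of_coprime[OF q] quotient_of_div[OF q] by auto
  have d0: "d \<noteq> 0" using assms(2) by auto
  have "(of_int n * of_int d :: rat) = of_int a * of_int e"
    using assms(1) x e d0 by (simp add: field_simps)
  then have "n * d = a * e" by (metis of_int_eq_iff of_int_mult)
  then have "e dvd d" using cop by (metis coprime_commute coprime_dvd_mult_right_iff dvd_triv_right)
  then show ?thesis using assms(2) q by (auto simp: p_integral_def)
qed

lemma p_integral_of_int: "p > 1 \<Longrightarrow> of_int a \<in> p_integral p"
  by (rule p_integralI[of _ a 1]) auto

lemma least_residue_unique:
  assumes "prime p" and "b \<in> p_integral p"
  shows "\<exists>!r. r < p \<and> p_cong p (of_nat p) b (of_nat r)"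
proof -
  obtain n e where q: "quotient_of b = (n, e)" by force
  have e: "e > 0" and b: "b = of_int n / of_int e" and pe: "\<not> int p dvd e"
    using quotient_of_denom_pos[OF q] quotient_of_div[OF q] assms(2) q
    by (auto simp: p_integral_def)
  have p1: "p > 1" using assms(1) by (rule prime_gt_1_nat)
  have pr: "prime (int p)" using assms(1) by simp
  have int: "of_nat r \<in> p_integral p" for r
    using p_integral_of_int[OF p1, of "int r"] by simp
  have iff: "p_cong p (of_nat p) b (of_nat r) \<longleftrightarrow> [n = int r * e] (mod int p)" for r
  proof
    assume "p_cong p (of_nat p) b (of_nat r)"
    then obtain c where c: "c \<in> p_integral p" "b - of_nat r = of_nat p * c"
      by (auto simp: p_cong_def)
    obtain m f where qc: "quotient_of c = (m, f)" by force
    have f: "f > 0" and cf: "c = of_int m / of_int f" and pf: "\<not> int p dvd f"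
      using quotient_of_denom_pos[OF qc] quotient_of_div[OF qc] c(1) qc
      by (auto simp: p_integral_def)
    have "(of_int ((n - int r * e) * f) :: rat) = of_int (int p * (m * e))"
      using c(2) b cf e f by (simp add: field_simps)
    then have "(n - int r * e) * f = int p * (m * e)" by (simp only: of_int_eq_iff)
    then have "int p dvd (n - int r * e) * f" by simp
    then have "int p dvd n - int r * e" using pr pf prime_dvd_multD by blast
    then show "[n = int r * e] (mod int p)" by (simp add: cong_iff_dvd_diff)
  next
    assume "[n = int r * e] (mod int p)"
    then obtain k where k: "n - int r * e = int p * k"
      by (auto simp: cong_iff_dvd_diff)
    have "(of_int (n - int r * e) :: rat) = of_int (int p * k)" using k by simp
    then have "b - of_nat r = of_nat p * (of_int k / of_int e)"
      using b e by (simp add: field_simps)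
    moreover have "of_int k / of_int e \<in> p_integral p" using p_integralI pe by blast
    ultimately show "p_cong p (of_nat p) b (of_nat r)"
      using assms(2) int unfolding p_cong_def by blast
  qed
  have cop: "coprime e (int p)"
    using pr pe prime_imp_coprime coprime_commute by blast
  then obtain y where y: "[e * y = 1] (mod int p)" using cong_solve_coprime_int by blast
  define r where "r = nat ((n * y) mod int p)"
  have r: "int r = (n * y) mod int p" using p1 by (simp add: r_def)
  have rp: "r < p" using r p1 by (metis of_nat_less_iff pos_mod_bound of_nat_0_less_iff order_less_trans zero_less_one)
  have "[int r * e = n * y * e] (mod int p)"
    using r by (simp add: cong_def mod_mult_left_eq)
  also have "[n * y * e = n * 1] (mod int p)"
    using cong_scalar_left[OF y, of n] by (simp add: ac_simps)
  finally have "[n = int r * e] (mod int p)" by (simp add: cong_sym)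
  moreover have "r' = r''" if "r' < p" "r'' < p"
    "[n = int r' * e] (mod int p)" "[n = int r'' * e] (mod int p)" for r' r''
  proof -
    have "[int r' * e = int r'' * e] (mod int p)" using that cong_sym cong_trans by blast
    then have "[int r' = int r''] (mod int p)" using cop cong_mult_rcancel by blast
    then show ?thesis using that by (simp add: cong_def)
  qed
  ultimately show ?thesis using rp by (auto simp: iff)
qed

end

(* With h = (p - 1)/2, n = p - r, m = h - n and t = s + 1 we have b = t p - n. Modulo p^2 the weight
   (2k choose k)^2 / 16^k equals c_k = (-1)^k (h choose k) (h + k choose k), because
   (2k + 1)^2 and (2k + 1)^2 - p^2 agree. The c_k are the residues in a partial fraction expansion:
     sum_{k <= h} c_k / (x + k) = (-1)^h prod_{j=1..h} (x - j) / prod_{k=0..h} (x + k).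
   At x = b each factor is a p-adic unit shifted by t p, apart from x + n = t p, so expanding the
   products to first order in p gives (c_n / t) (1 + t p (2 H_n - H_m - H_{h+n})), and
   H_{h+n} = H_m modulo p. The terms with h < k < p vanish modulo p^2. The other forms come from
   (p - 1)! = (-1)^j j! (p - 1 - j)! (1 - p H_j) modulo p^2 and from Morley's congruence
   (-1)^h (2h choose h) = 4^(p-1) modulo p^2. *)
theory Submission
  imports Defs "HOL-Computational_Algebra.Polynomial"
begin

section \<open>The local ring of p-integral rationals, its units, and congruence modulo p^2\<close>

lemma p_integral_iff:
  "x \<in> p_integral p \<longleftrightarrow> (\<exists>a d. x = of_int a / of_int d \<and> \<not> int p dvd d)"
proof
  assume x: "x \<in> p_integral p"
  obtain n e where q: "quotient_of x = (n, e)" by force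
  then show "\<exists>a d. x = of_int a / of_int d \<and> \<not> int p dvd d"
    using x quotient_of_div[OF q] by (auto simp: p_integral_def)
qed (auto intro: p_integralI)

lemma p_cong_iff:
  assumes "m \<noteq> 0"
  shows "p_cong p m x y \<longleftrightarrow> x \<in> p_integral p \<and> y \<in> p_integral p \<and> (x - y) / m \<in> p_integral p"
proof -
  have "(\<exists>c \<in> p_integral p. x - y = m * c) \<longleftrightarrow> (x - y) / m \<in> p_integral p"
    using assms by (metis nonzero_mult_div_cancel_left times_divide_eq_right)
  then show ?thesis by (auto simp: p_cong_def)
qed

locale p_local =
  fixes p :: nat
  assumes prime_p: "prime p"
begin

abbreviation Zp :: "rat set" where "Zp \<equiv> p_integral p"
abbreviation P :: rat where "P \<equiv> of_nat p"
abbreviation cong2 :: "rat \<Rightarrow> rat \<Rightarrow> bool"  (infix "\<approx>" 50)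
  where "x \<approx> y \<equiv> p_cong p (P\<^sup>2) x y"

definition units :: "rat set" where
  "units = {x \<in> Zp. x \<noteq> 0 \<and> 1 / x \<in> Zp}"

lemma P_nz [simp]: "p \<noteq> 0" "p > 0"
  using prime_p prime_gt_0_nat by auto

lemma prime_int_p: "prime (int p)"
  using prime_p by simp

lemma Zp_of_int [simp, intro]: "of_int a \<in> Zp"
  using p_integral_of_int prime_gt_1_nat[OF prime_p] by blast

lemma Zp_of_nat [simp, intro]: "of_nat a \<in> Zp"
  using Zp_of_int[of "int a"] by simp

lemma Zp_numeral [simp, intro]: "numeral a \<in> Zp" "0 \<in> Zp" "1 \<in> Zp"
  using Zp_of_nat[of "numeral a"] Zp_of_nat[of 0] Zp_of_nat[of 1] by simp_all

lemma Zp_add [simp, intro]: "x + y \<in> Zp" if "x \<in> Zp" "y \<in> Zp"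
proof -
  obtain a d where a: "x = of_int a / of_int d" "\<not> int p dvd d" using \<open>x \<in> Zp\<close> p_integral_iff by auto
  obtain a' d' where b: "y = of_int a' / of_int d'" "\<not> int p dvd d'" using \<open>y \<in> Zp\<close> p_integral_iff by auto
  have "d \<noteq> 0" "d' \<noteq> 0" using a b by auto
  then have "x + y = of_int (a * d' + a' * d) / of_int (d * d')"
    using a b by (simp add: field_simps)
  moreover have "\<not> int p dvd d * d'" using a b prime_int_p by (simp add: prime_dvd_mult_iff)
  ultimately show ?thesis by (rule p_integralI)
qed

lemma Zp_mult [simp, intro]: "x * y \<in> Zp" if "x \<in> Zp" "y \<in> Zp"
proof -
  obtain a d where a: "x = of_int a / of_int d" "\<not> int p dvd d" using \<open>x \<in> Zp\<close> p_integral_iff by auto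
  obtain a' d' where b: "y = of_int a' / of_int d'" "\<not> int p dvd d'" using \<open>y \<in> Zp\<close> p_integral_iff by auto
  have "x * y = of_int (a * a') / of_int (d * d')"
    using a b by (simp add: field_simps)
  moreover have "\<not> int p dvd d * d'" using a b prime_int_p by (simp add: prime_dvd_mult_iff)
  ultimately show ?thesis by (rule p_integralI)
qed

lemma Zp_minus [simp, intro]: "- x \<in> Zp" if "x \<in> Zp"
  using Zp_mult[OF Zp_of_int[of "-1"] that] by simp

lemma Zp_diff [simp, intro]: "x - y \<in> Zp" if "x \<in> Zp" "y \<in> Zp"
  using Zp_add[of x "- y"] that by simp

lemma Zp_power [simp, intro]: "x ^ k \<in> Zp" if "x \<in> Zp"
  using that by (induction k) auto

lemma Zp_sum: "sum f A \<in> Zp" if "\<And>i. i \<in> A \<Longrightarrow> f i \<in> Zp"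
  using that by (induction A rule: infinite_finite_induct) auto

lemma Zp_prod: "prod f A \<in> Zp" if "\<And>i. i \<in> A \<Longrightarrow> f i \<in> Zp"
  using that by (induction A rule: infinite_finite_induct) auto

lemma inverse_P_notin_Zp: "1 / P \<notin> Zp"
proof
  assume "1 / P \<in> Zp"
  then obtain a d where a: "1 / P = of_int a / of_int d" "\<not> int p dvd d"
    using p_integral_iff by auto
  have "d \<noteq> 0" using a by auto
  then have "(of_int d :: rat) = of_int (int p * a)" using a by (simp add: field_simps)
  then have "d = int p * a" by (simp only: of_int_eq_iff)
  then show False using a by simp
qed

text \<open>The ring is local with maximal ideal generated by p: a fraction whose numerator is prime
  to p can be inverted, while an invertible multiple of p would make 1/p p-integral.\<close>

lemma units_iff: "x \<in> units \<longleftrightarrow> x \<in> Zp \<and> x / P \<notin> Zp"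
proof
  assume x: "x \<in> units"
  have "1 / P \<in> Zp" if "x / P \<in> Zp"
  proof -
    have "(x / P) * (1 / x) \<in> Zp" using x that unfolding units_def by blast
    then show ?thesis using x by (simp add: units_def)
  qed
  then show "x \<in> Zp \<and> x / P \<notin> Zp" using x inverse_P_notin_Zp by (auto simp: units_def)
next
  assume x: "x \<in> Zp \<and> x / P \<notin> Zp"
  then obtain a d where a: "x = of_int a / of_int d" "\<not> int p dvd d"
    using p_integral_iff by auto
  have x0: "x \<noteq> 0" using x by auto
  have "\<not> int p dvd a"
  proof
    assume "int p dvd a"
    then obtain a' where "a = int p * a'" by blast
    then have "x / P = of_int a' / of_int d" using a by simp
    then show False using x a p_integralI by blast
  qed
  then have "1 / x \<in> Zp" using a by (intro p_integralI[of _ d a]) auto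
  then show "x \<in> units" using x x0 by (simp add: units_def)
qed

lemma units_of_int: "of_int a \<in> units" if "\<not> int p dvd a"
proof -
  have "1 / of_int a \<in> Zp" using that by (intro p_integralI[of _ 1 a]) auto
  then show ?thesis using that by (auto simp: units_def)
qed

lemma units_of_nat: "of_nat a \<in> units" if "\<not> p dvd a"
  using units_of_int[of "int a"] that by simp

lemma units_nz: "x \<in> units \<Longrightarrow> x \<noteq> 0"
  by (simp add: units_def)

lemma units_Zp: "x \<in> units \<Longrightarrow> x \<in> Zp"
  by (simp add: units_def)

lemma Zp_divide [intro]: "x / y \<in> Zp" if "x \<in> Zp" "y \<in> units"
proof -
  have "x * (1 / y) \<in> Zp" using that by (intro Zp_mult) (simp_all add: units_def)
  then show ?thesis by simp
qed

lemma units_mult [intro]: "x * y \<in> units" if "x \<in> units" "y \<in> units"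
proof -
  have "(1 / x) * (1 / y) \<in> Zp" using that by (intro Zp_mult) (simp_all add: units_def)
  then show ?thesis using that by (simp add: units_def)
qed

lemma units_1 [simp]: "1 \<in> units"
  by (simp add: units_def)

lemma units_minus [intro]: "- x \<in> units" if "x \<in> units"
proof -
  have "- (1 / x) \<in> Zp" using that by (intro Zp_minus) (simp add: units_def)
  then show ?thesis using that by (simp add: units_def)
qed

lemma units_power [intro]: "x ^ k \<in> units" if "x \<in> units"
  using that by (induction k) auto

lemma units_prod: "prod f A \<in> units" if "\<And>i. i \<in> A \<Longrightarrow> f i \<in> units"
  using that by (induction A rule: infinite_finite_induct) auto

lemma units_add_P: "x + P * y \<in> units" if "x \<in> units" "y \<in> Zp"
proof -
  have "x / P \<in> Zp" if "(x + P * y) / P \<in> Zp"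
  proof -
    have "(x + P * y) / P - y \<in> Zp" using that \<open>y \<in> Zp\<close> by blast
    then show ?thesis by (simp add: field_simps)
  qed
  then show ?thesis using that by (auto simp: units_iff)
qed

lemma cong2_iff: "x \<approx> y \<longleftrightarrow> x \<in> Zp \<and> y \<in> Zp \<and> (x - y) / P\<^sup>2 \<in> Zp"
  by (simp add: p_cong_iff)

lemma cong2_refl [intro]: "x \<approx> x" if "x \<in> Zp"
  using that by (simp add: cong2_iff)

lemma cong2_sym: "x \<approx> y \<Longrightarrow> y \<approx> x"
  using Zp_minus[of "(x - y) / P\<^sup>2"] by (simp add: cong2_iff minus_divide_left)

lemma cong2_add: "x + x' \<approx> y + y'" if "x \<approx> y" "x' \<approx> y'"
proof -
  have "(x - y) / P\<^sup>2 + (x' - y') / P\<^sup>2 \<in> Zp" using that by (auto simp: cong2_iff)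
  then show ?thesis using that by (auto simp: cong2_iff add_divide_distrib diff_divide_distrib algebra_simps)
qed

lemma cong2_trans [trans]: "x \<approx> z" if "x \<approx> y" "y \<approx> z"
proof -
  have "(x - y) / P\<^sup>2 + (y - z) / P\<^sup>2 \<in> Zp" using that by (auto simp: cong2_iff)
  then show ?thesis using that by (auto simp: cong2_iff diff_divide_distrib)
qed

lemma cong2_mult_left: "z * x \<approx> z * y" if "x \<approx> y" "z \<in> Zp"
proof -
  have "z * ((x - y) / P\<^sup>2) \<in> Zp" using that by (intro Zp_mult) (simp_all add: cong2_iff)
  also have "z * ((x - y) / P\<^sup>2) = (z * x - z * y) / P\<^sup>2" by (simp add: right_diff_distrib)
  finally show ?thesis using that by (auto simp: cong2_iff)
qed

lemma cong2_mult_right: "x * z \<approx> y * z" if "x \<approx> y" "z \<in> Zp"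
  using cong2_mult_left[OF that] by (simp add: mult.commute)

text \<open>Many congruences below are proved after multiplication by a unit, often a product of
  factorials; this removes that factor again.\<close>

lemma cong2_cancel: "x \<approx> y" if "x * z \<approx> y * z" "z \<in> units" "x \<in> Zp" "y \<in> Zp"
proof -
  have "(1 / z) * (x * z) \<approx> (1 / z) * (y * z)"
    using that by (intro cong2_mult_left) (auto simp: units_def)
  then show ?thesis using that by (simp add: units_def)
qed

lemma cong2_sum: "sum f A \<approx> sum g A" if "\<And>i. i \<in> A \<Longrightarrow> f i \<approx> g i"
  using that by (induction A rule: infinite_finite_induct) (auto intro: cong2_add)

lemma cong2_I: "x \<approx> y" if "x - y = P\<^sup>2 * z" "x \<in> Zp" "y \<in> Zp" "z \<in> Zp"
  using that by (simp add: cong2_iff)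

text \<open>The cross term \<open>P^2 * x * y\<close> drops out, so first-order corrections multiply
  by adding their coefficients.\<close>

lemma cong2_linear: "(1 + P * x) * (1 + P * y) \<approx> 1 + P * (x + y)" if "x \<in> Zp" "y \<in> Zp"
  using that by (intro cong2_I[of _ _ "x * y"]) (auto simp: algebra_simps power2_eq_square)

text \<open>Each factor is \<open>f i * (1 + P * (y / f i))\<close>, and by
  \<open>cong2_linear\<close> the corrections add up. The harmonic numbers in the later congruences
  arise from this sum of reciprocals.\<close>

lemma cong2_prod_shift:
  assumes "finite A" "\<And>i. i \<in> A \<Longrightarrow> f i \<in> units" "y \<in> Zp"
  shows "(\<Prod>i\<in>A. f i + P * y) \<approx> (\<Prod>i\<in>A. f i) * (1 + P * (y * (\<Sum>i\<in>A. 1 / f i)))"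
  using assms
proof (induction A rule: finite_induct)
  case (insert a A)
  define S where "S = (\<Sum>i\<in>A. 1 / f i)"
  have S: "S \<in> Zp" unfolding S_def using insert.prems by (intro Zp_sum) (simp add: units_def)
  have a: "f a \<in> Zp" "f a \<noteq> 0" "1 / f a \<in> Zp" using insert.prems by (auto simp: units_def)
  have pr: "(\<Prod>i\<in>A. f i) \<in> Zp" using insert.prems by (intro Zp_prod units_Zp) auto
  have "(\<Prod>i\<in>insert a A. f i + P * y) = (f a + P * y) * (\<Prod>i\<in>A. f i + P * y)"
    using insert by simp
  also have "\<dots> \<approx> (f a + P * y) * ((\<Prod>i\<in>A. f i) * (1 + P * (y * S)))"
    using insert a by (intro cong2_mult_left) (auto simp: S_def)
  also have "(f a + P * y) * ((\<Prod>i\<in>A. f i) * (1 + P * (y * S)))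
      = (f a * (\<Prod>i\<in>A. f i)) * ((1 + P * (y * (1 / f a))) * (1 + P * (y * S)))"
    using a by (simp add: field_simps)
  also have "\<dots> \<approx> (f a * (\<Prod>i\<in>A. f i)) * (1 + P * (y * (1 / f a) + y * S))"
    using a S pr insert.prems by (intro cong2_mult_left cong2_linear Zp_mult) auto
  finally show ?case using insert by (simp add: S_def algebra_simps)
qed auto

end

section \<open>The coefficients c_k and their partial fraction expansion\<close>

text \<open>The coefficient of x^k in the shifted Legendre polynomial P_h(1 - 2x).\<close>

definition legendre_coeff :: "nat \<Rightarrow> nat \<Rightarrow> rat" where
  "legendre_coeff h k = (- 1) ^ k * of_nat (h choose k) * of_nat ((h + k) choose k)"

lemma prod_neg_shift: "(\<Prod>j=1..h. - of_nat k - of_nat j :: rat) * fact k = (- 1) ^ h * fact (h + k)"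
proof (induction h)
  case (Suc h)
  have "(\<Prod>j=1..Suc h. - of_nat k - of_nat j :: rat) * fact k
      = (\<Prod>j=1..h. - of_nat k - of_nat j) * fact k * (- of_nat k - of_nat (Suc h))"
    by simp
  also have "\<dots> = (- 1) ^ Suc h * fact (Suc h + k)"
    unfolding Suc by (simp add: algebra_simps)
  finally show ?case .
qed simp

lemma prod_diff_remove:
  assumes "k \<le> h"
  shows "(\<Prod>l\<in>{0..h} - {k}. of_nat l - of_nat k :: rat) = (- 1) ^ k * fact k * fact (h - k)"
proof -
  have split: "{0..h} - {k} = {0..<k} \<union> {k+1..h}" using assms by auto
  have "(\<Prod>l\<in>{0..h} - {k}. of_nat l - of_nat k :: rat)
     = (\<Prod>l\<in>{0..<k}. of_nat l - of_nat k) * (\<Prod>l\<in>{k+1..h}. of_nat l - of_nat k)"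
    unfolding split by (rule prod.union_disjoint) auto
  also have "(\<Prod>l\<in>{0..<k}. of_nat l - of_nat k :: rat) = (\<Prod>l\<in>{1..k}. - of_nat l)"
    by (rule prod.reindex_bij_witness[of _ "\<lambda>i. k - i" "\<lambda>i. k - i"]) auto
  also have "\<dots> = (- 1) ^ k * fact k"
    by (simp add: prod_uminus fact_prod)
  also have "(\<Prod>l\<in>{k+1..h}. of_nat l - of_nat k :: rat) = (\<Prod>l\<in>{1..h-k}. of_nat l)"
    by (rule prod.reindex_bij_witness[of _ "\<lambda>i. i + k" "\<lambda>i. i - k"]) auto
  also have "\<dots> = fact (h - k)" by (simp add: fact_prod)
  finally show ?thesis .
qed

lemma legendre_coeff_fact:
  assumes "k \<le> h"
  shows "legendre_coeff h k * (fact k)\<^sup>2 * fact (h - k) = (- 1) ^ k * fact (h + k)"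
  using assms by (simp add: legendre_coeff_def binomial_fact power2_eq_square field_simps)

text \<open>The condition at the pole x = -k: c_k times the other denominator factors is the
  numerator evaluated there. After multiplication by k! both sides equal (h + k)!.\<close>

lemma legendre_coeff_residue:
  assumes "k \<le> h"
  shows "legendre_coeff h k * (\<Prod>l\<in>{0..h} - {k}. of_nat l - of_nat k)
    = (- 1) ^ h * (\<Prod>j=1..h. - of_nat k - of_nat j)"
proof -
  have "(legendre_coeff h k * ((- 1) ^ k * fact k * fact (h - k))) * fact k
      = (-1) ^ k * (legendre_coeff h k * (fact k)\<^sup>2 * fact (h - k))"
    by (simp add: power2_eq_square)
  also have "\<dots> = fact (h + k)" 
    by (simp add: legendre_coeff_fact[OF assms])
  also have "\<dots> = (- 1) ^ h * (\<Prod>j=1..h. - of_nat k - of_nat j) * fact k"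
    unfolding mult.assoc prod_neg_shift by simp
  finally show ?thesis unfolding prod_diff_remove[OF assms] by simp
qed

text \<open>With denominators cleared, both sides become polynomials \<open>F\<close> and
  \<open>G\<close> of degree at most h. They agree at the h + 1 points 0, -1, ..., -h by the residue
  identity, hence everywhere.\<close>

lemma legendre_coeff_partial_fractions:
  fixes x :: rat
  assumes "\<And>k. k \<le> h \<Longrightarrow> x + of_nat k \<noteq> 0"
  shows "(\<Sum>k=0..h. legendre_coeff h k / (x + of_nat k)) * (\<Prod>k=0..h. x + of_nat k)
     = (- 1) ^ h * (\<Prod>j=1..h. x - of_nat j)"
proof -
  define F where "F = (\<Sum>k=0..h. smult (legendre_coeff h k) (\<Prod>l\<in>{0..h} - {k}. [:of_nat l, 1:]))"
  define G :: "rat poly" where "G = smult ((- 1) ^ h) (\<Prod>j=1..h. [:- of_nat j, 1:])"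
  have "degree (\<Prod>l\<in>{0..h} - {k}. [:of_nat l, 1 :: rat:]) \<le> h" if "k \<le> h" for k
    using degree_prod_sum_le[of "{0..h} - {k}" "\<lambda>l. [:of_nat l, 1 :: rat:]"] that by (simp add: o_def)
  then have dF: "degree F \<le> h" unfolding F_def
    by (intro degree_sum_le) (auto intro: order.trans[OF degree_smult_le])
  have dG: "degree G \<le> h" unfolding G_def
    using degree_prod_sum_le[of "{1..h}" "\<lambda>l. [:- of_nat l, 1 :: rat:]"]
    by (intro order.trans[OF degree_smult_le]) (simp add: o_def)
  define A where "A = (\<lambda>k. - of_nat k :: rat) ` {0..h}"
  have card: "card A = Suc h" unfolding A_def by (subst card_image) (auto simp: inj_on_def)
  have "poly F y = poly G y" if y: "y \<in> A" for y
  proof -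
    obtain i where i: "i \<le> h" "y = - of_nat i" using y unfolding A_def by force
    \<comment> \<open>At y = -i every summand with k \<noteq> i contains the vanishing factor with l
      = i, so only the summand k = i survives.\<close>
    have "poly F y = (\<Sum>k=0..h. if k = i then legendre_coeff h k * (\<Prod>l\<in>{0..h} - {k}. of_nat l + y) else 0)"
      unfolding F_def poly_sum
    proof (intro sum.cong refl)
      fix k assume "k \<in> {0..h}"
      have "(\<Prod>l\<in>{0..h} - {k}. of_nat l + y) = 0" if "k \<noteq> i"
        using that i by (intro prod_zero) auto
      then show "poly (smult (legendre_coeff h k) (\<Prod>l\<in>{0..h} - {k}. [:of_nat l, 1:])) y
         = (if k = i then legendre_coeff h k * (\<Prod>l\<in>{0..h} - {k}. of_nat l + y) else 0)"
        by (simp add: poly_prod)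
    qed
    also have "\<dots> = legendre_coeff h i * (\<Prod>l\<in>{0..h} - {i}. of_nat l - of_nat i)" using i by simp
    also have "\<dots> = poly G y" unfolding legendre_coeff_residue[OF i(1)] using i
      by (simp add: G_def poly_prod minus_diff_commute)
    finally show ?thesis .
  qed
  then have FG: "F = G"
    using poly_eqI_degree[of A F G] dF dG card by auto
  have "(\<Sum>k=0..h. legendre_coeff h k / (x + of_nat k)) * (\<Prod>k=0..h. x + of_nat k)
      = (\<Sum>k=0..h. legendre_coeff h k * (\<Prod>l\<in>{0..h} - {k}. of_nat l + x))"
    unfolding sum_distrib_right
  proof (intro sum.cong refl)
    fix k assume k: "k \<in> {0..h}"
    have "(\<Prod>k=0..h. x + of_nat k) = (x + of_nat k) * (\<Prod>l\<in>{0..h} - {k}. x + of_nat l)"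
      using k by (intro prod.remove) auto
    then show "legendre_coeff h k / (x + of_nat k) * (\<Prod>k=0..h. x + of_nat k)
      = legendre_coeff h k * (\<Prod>l\<in>{0..h} - {k}. of_nat l + x)"
      using assms[of k] k by (simp add: add.commute)
  qed
  also have "\<dots> = poly F x" by (simp add: F_def poly_sum poly_prod)
  also have "\<dots> = (- 1) ^ h * (\<Prod>j=1..h. x - of_nat j)" by (simp add: FG G_def poly_prod)
  finally show ?thesis .
qed

section \<open>Harmonic differences, the double factorial, and recurrences for the weights and the
  c_k\<close>

lemma harm_rat_0 [simp]: "harm_rat 0 = 0"
  by (simp add: harm_rat_def)

lemma harm_rat_Suc: "harm_rat (Suc k) = harm_rat k + 1 / of_nat (Suc k)"
  by (simp add: harm_rat_def)

lemma harm_rat_diff: "harm_rat (n + k) - harm_rat n = (\<Sum>j=1..k. 1 / of_nat (n + j))"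
  by (induction k) (simp_all add: harm_rat_Suc add_ac)

text \<open>The even factors of (2h)! contribute 2^h h!, and the odd ones form the remaining
  product.\<close>

lemma fact_double: "(fact (2 * h) :: rat) = 2 ^ h * fact h * (\<Prod>j=1..h. 2 * of_nat j - 1)"
  by (induction h) (simp_all add: algebra_simps)

text \<open>The ratio of consecutive weights is (2k + 1)^2 / (2k + 2)^2; it is kept free of division
  to be compared with \<open>legendre_coeff_step\<close>.\<close>

lemma central_binomial_step:
  "(of_nat ((2 * Suc k) choose Suc k))\<^sup>2 / 16 ^ Suc k * (4 * (of_nat (Suc k))\<^sup>2)
    = ((of_nat ((2 * k) choose k))\<^sup>2 / 16 ^ k * (2 * of_nat k + 1)\<^sup>2 :: rat)"
proof -
  have "of_nat ((2 * Suc k) choose Suc k) * of_nat (Suc k)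
      = (2 * (2 * of_nat k + 1) * of_nat ((2 * k) choose k) :: rat)"
  proof -
    \<comment> \<open>Absorption is applied twice, with the symmetry of row 2k + 1 exchanging the
      lower indices k and k + 1 in between.\<close>
    have "((2 * Suc k) choose Suc k) * Suc k = 2 * (Suc k * (Suc (2 * k) choose Suc k))"
      using Suc_times_binomial[of k "Suc (2 * k)"] binomial_symmetric[of k "Suc (2 * k)"]
      by (simp add: mult.commute del: binomial_Suc_Suc)
    also have "Suc k * (Suc (2 * k) choose Suc k) = Suc (2 * k) * ((2 * k) choose k)"
      by (rule Suc_times_binomial)
    finally have "of_nat (((2 * Suc k) choose Suc k) * Suc k)
        = (of_nat (2 * (Suc (2 * k) * ((2 * k) choose k))) :: rat)" by (simp only:)
    then show ?thesis by (simp add: algebra_simps del: binomial_Suc_Suc)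
  qed
  moreover have "x\<^sup>2 / 16 ^ Suc k * (4 * u\<^sup>2) = y\<^sup>2 / 16 ^ k * z\<^sup>2"
    if "x * u = 2 * z * y" for x y z u :: rat
  proof -
    have "(x * u)\<^sup>2 = 4 * (z\<^sup>2 * y\<^sup>2)" unfolding that by (simp add: power_mult_distrib)
    moreover have "x\<^sup>2 / 16 ^ Suc k * (4 * u\<^sup>2) = (x * u)\<^sup>2 / (4 * 16 ^ k)"
      by (simp add: power_mult_distrib)
    ultimately show ?thesis by simp
  qed
  ultimately show ?thesis by blast
qed

text \<open>The ratio c_(k+1) / c_k is -(h - k)(h + k + 1) / (k + 1)^2, and -4(h - k)(h + k + 1) is
  a difference of two odd squares. For p = 2h + 1 this is the recurrence of the weights with p^2
  subtracted.\<close>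

lemma legendre_coeff_step:
  assumes "k < h"
  shows "legendre_coeff h (Suc k) * (4 * (of_nat (Suc k))\<^sup>2)
    = legendre_coeff h k * ((2 * of_nat k + 1)\<^sup>2 - (2 * of_nat h + 1)\<^sup>2)"
proof -
  \<comment> \<open>Here \<open>Suc d\<close> is h - k, so the factorial of h - k splits off its top
    factor.\<close>
  obtain d where h: "h = k + Suc d" using assms less_imp_Suc_add by auto
  have hd: "(of_nat h :: rat) = of_nat k + of_nat d + 1" by (simp add: h)
  have fS: "fact (Suc k) = of_nat (Suc k) * (fact k :: rat)"
    "fact (Suc d) = of_nat (Suc d) * (fact d :: rat)"
    "fact (h + Suc k) = of_nat (h + Suc k) * (fact (h + k) :: rat)" by simp_all
  have 1: "legendre_coeff h (Suc k) * (of_nat (Suc k) * fact k)\<^sup>2 * fact d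
      = - ((- 1) ^ k) * (of_nat (h + Suc k) * fact (h + k))"
    using legendre_coeff_fact[of "Suc k" h] by (simp only: fS) (simp add: h del: of_nat_Suc fact_Suc)
  have 2: "legendre_coeff h k * (fact k)\<^sup>2 * (of_nat (Suc d) * fact d) = (- 1) ^ k * fact (h + k)"
    using legendre_coeff_fact[of k h] by (simp add: h del: of_nat_Suc)
  have "legendre_coeff h (Suc k) * (4 * (of_nat (Suc k))\<^sup>2) * ((fact k)\<^sup>2 * (of_nat (Suc d) * fact d))
      = 4 * of_nat (Suc d) * (legendre_coeff h (Suc k) * (of_nat (Suc k) * fact k)\<^sup>2 * fact d)"
    by (simp only: power_mult_distrib ac_simps)
  also have "\<dots> = (- 1) ^ k * fact (h + k) * ((2 * of_nat k + 1)\<^sup>2 - (2 * of_nat h + 1)\<^sup>2)"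
    unfolding 1 by (simp add: hd power2_eq_square algebra_simps)
  also have "\<dots> = legendre_coeff h k * ((2 * of_nat k + 1)\<^sup>2 - (2 * of_nat h + 1)\<^sup>2)
      * ((fact k)\<^sup>2 * (of_nat (Suc d) * fact d))"
    unfolding 2[symmetric] by (simp only: ac_simps)
  finally show ?thesis by simp
qed

section \<open>Weights, harmonic numbers and factorials modulo powers of an odd prime p = 2h +
  1\<close>

locale odd_prime = p_local +
  fixes h :: nat
  assumes p_eq: "p = 2 * h + 1"
begin

lemma P_eq: "P = 2 * of_nat h + 1"
  by (simp add: p_eq)

lemma less_p: "a \<le> h \<Longrightarrow> a < p" "a < h \<Longrightarrow> Suc (h + a) < p"
  by (simp_all add: p_eq)

lemma units_small: "of_nat a \<in> units" if "0 < a" "a < p"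
  using that by (intro units_of_nat) (auto dest: dvd_imp_le)

lemma units_diff: "of_nat a - of_nat b \<in> units" if "a \<noteq> b" "a < p" "b < p"
proof (cases "a < b")
  case True
  then have "- of_nat (b - a) \<in> units" using that by (intro units_minus units_small) auto
  then show ?thesis using True by simp
next
  case False
  then have "of_nat (a - b) \<in> units" using that by (intro units_small) auto
  then show ?thesis using False by simp
qed

lemma units_fact: "fact a \<in> units" if "a < p"
  using that unfolding fact_prod of_nat_prod by (intro units_prod units_small) auto

lemma units_2: "2 \<in> units"
  using units_small[of 2] prime_p prime_ge_2_nat[OF prime_p] p_eq
  by (cases "p = 2") auto

lemma units_4: "4 \<in> units"
  using units_mult[OF units_2 units_2] by simp

lemma units_16: "16 \<in> units"
  using units_mult[OF units_4 units_4] by simp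

lemma Zp_harm: "harm_rat a \<in> Zp" if "a < p"
  using that unfolding harm_rat_def by (intro Zp_sum Zp_divide units_small) auto

lemma Zp_legendre_coeff: "legendre_coeff h k \<in> Zp"
  unfolding legendre_coeff_def using Zp_of_int[of "-1"] by (intro Zp_mult Zp_power) auto

text \<open>Both sequences start at 1 and their recurrences differ only by p^2 in the multiplier.
  The common divisor 4(k + 1)^2 is a unit, since k + 1 stays at most h.\<close>

lemma central_binomial_cong_legendre_coeff:
  assumes "k \<le> h"
  shows "(of_nat ((2 * k) choose k))\<^sup>2 / 16 ^ k \<approx> legendre_coeff h k"
  using assms
proof (induction k)
  case (Suc k)
  let ?u = "4 * (of_nat (Suc k))\<^sup>2 :: rat"
  have "(of_nat ((2 * Suc k) choose Suc k))\<^sup>2 / 16 ^ Suc k * ?u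
      = (of_nat ((2 * k) choose k))\<^sup>2 / 16 ^ k * (2 * of_nat k + 1)\<^sup>2"
    by (rule central_binomial_step)
  also have "\<dots> \<approx> legendre_coeff h k * (2 * of_nat k + 1)\<^sup>2"
    using Suc by (intro cong2_mult_right Zp_power Zp_add Zp_mult) auto
  also have "\<dots> \<approx> legendre_coeff h k * ((2 * of_nat k + 1)\<^sup>2 - P\<^sup>2)"
    using Zp_legendre_coeff by (intro cong2_I[of _ _ "legendre_coeff h k"] Zp_mult Zp_diff Zp_power Zp_add)
      (auto simp: algebra_simps)
  also have "\<dots> = legendre_coeff h (Suc k) * ?u"
    using legendre_coeff_step[of k h] Suc.prems P_eq by simp
  finally have *: "(of_nat ((2 * Suc k) choose Suc k))\<^sup>2 / 16 ^ Suc k * ?u \<approx> legendre_coeff h (Suc k) * ?u" .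
  have "?u \<in> units"
    using Suc.prems less_p by (intro units_mult units_power units_4 units_small) auto
  moreover have "(of_nat ((2 * Suc k) choose Suc k))\<^sup>2 / 16 ^ Suc k \<in> Zp"
    by (intro Zp_divide units_power units_16 Zp_power Zp_of_nat)
  ultimately show ?case using cong2_cancel[OF *] Zp_legendre_coeff by blast
qed (simp add: legendre_coeff_def cong2_refl)

text \<open>Passing from d to d + 1 adds 1/x + 1/y with x = h + d + 1 and y = h - d. Since x + y =
  p, this is p/(xy), a p-integral multiple of p.\<close>

lemma harm_reflect: "(harm_rat (h + d) - harm_rat (h - d)) / P \<in> Zp" if "d \<le> h"
  using that
proof (induction d)
  case (Suc d)
  let ?x = "of_nat (Suc (h + d)) :: rat" and ?y = "of_nat (h - d) :: rat"
  have u: "?x \<in> units" "?y \<in> units"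
    using Suc.prems less_p by (intro units_small; simp)+
  have nz: "?x \<noteq> 0" "?y \<noteq> 0" using u units_nz by blast+
  have eq: "h - d = Suc (h - Suc d)" using Suc.prems by simp
  have "harm_rat (h - d) = harm_rat (h - Suc d) + 1 / ?y"
    using harm_rat_Suc[of "h - Suc d"] eq by simp
  then have 1: "harm_rat (h + Suc d) - harm_rat (h - Suc d) = (harm_rat (h + d) - harm_rat (h - d)) + (1 / ?x + 1 / ?y)"
    using harm_rat_Suc[of "h + d"] by (simp del: of_nat_Suc)
  have "?x + ?y = P" using Suc.prems by (simp add: P_eq of_nat_diff)
  then have "1 / ?x + 1 / ?y = P / (?x * ?y)" using nz by (simp add: add_divide_eq_iff divide_add_eq_iff add.commute)
  then have "(1 / ?x + 1 / ?y) / P = 1 / (?x * ?y)" by simp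
  also have "\<dots> \<in> Zp" using u by (intro Zp_divide) auto
  finally have "(harm_rat (h + d) - harm_rat (h - d)) / P + (1 / ?x + 1 / ?y) / P \<in> Zp"
    using Suc by (intro Zp_add) auto
  then show ?case unfolding 1 add_divide_distrib .
qed simp

text \<open>The top j factors of (p - 1)! are p - i with i from 1 to j; their product is expanded to
  first order in p.\<close>

lemma fact_reflect:
  assumes "j < p"
  shows "fact (p - 1) \<approx> fact (p - 1 - j) * (- 1) ^ j * fact j * (1 - P * harm_rat j)"
proof -
  have "(fact (p - 1) :: rat) = fact (p - 1 - j) * (\<Prod>i=1..j. - of_nat i + P * 1)"
    using assms
  proof (induction j)
    case (Suc j)
    have "p - 1 - j = Suc (p - 1 - Suc j)" using Suc.prems by simp
    then have "(fact (p - 1 - j) :: rat) = of_nat (p - 1 - j) * fact (p - 1 - Suc j)"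
      by (metis fact_Suc)
    moreover have "(of_nat (p - 1 - j) :: rat) = - of_nat (Suc j) + P * 1"
      using Suc.prems by simp
    ultimately show ?case using Suc by (simp del: of_nat_Suc)
  qed simp
  also have "\<dots> \<approx> fact (p - 1 - j) * ((\<Prod>i=1..j. - of_nat i) * (1 + P * (1 * (\<Sum>i=1..j. 1 / - of_nat i))))"
    using assms by (intro cong2_mult_left cong2_prod_shift units_minus units_small units_Zp units_fact) auto
  also have "(\<Prod>i=1..j. - of_nat i :: rat) = (- 1) ^ j * fact j"
    by (simp add: prod_uminus fact_prod)
  also have "(\<Sum>i=1..j. 1 / - of_nat i :: rat) = - harm_rat j"
    by (simp add: harm_rat_def sum_negf)
  finally show ?thesis by (simp add: mult.assoc)
qed

section \<open>Morley's congruence modulo p^2 and the Fermat quotient\<close>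

text \<open>The signed binomial coefficient of Morley's congruence. It links the c_k to the Fermat
  quotient.\<close>

definition signed_central :: rat where "signed_central = (- 1) ^ h * of_nat ((2 * h) choose h)"

lemma Zp_signed: "(- 1) ^ k * x \<in> Zp" if "x \<in> Zp"
  using that Zp_minus[of 1] by (intro Zp_mult Zp_power) auto

lemma Zp_signed_central: "signed_central \<in> Zp"
  unfolding signed_central_def by (intro Zp_signed) auto

lemma signed_central_fact: "signed_central * (fact h)\<^sup>2 = (- 1) ^ h * fact (2 * h)"
  by (simp add: signed_central_def binomial_fact power2_eq_square field_simps)

text \<open>Multiplication by (n! m!)^2 turns the left side, up to sign, into (h + n)! m! (1 - p
  H_m). As h + n = p - 1 - m, \<open>fact_reflect\<close> at m identifies this with (p - 1)! = (2h)!
  up to sign, which the right side gives as well.\<close>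

lemma legendre_coeff_cong_signed_central:
  assumes "n + m = h"
  shows "legendre_coeff h n * (1 - P * harm_rat m) \<approx> (of_nat (h choose n))\<^sup>2 * signed_central"
proof (rule cong2_cancel)
  have m: "m < p" "n < p" "n \<le> h" "h - n = m" "p - 1 - m = h + n" "p - Suc m = h + n" "p - 1 = 2 * h"
    using assms p_eq by auto
  have sgn: "(- 1 :: rat) ^ n = (- 1) ^ h * (- 1) ^ m"
    using assms by (auto simp: power_add)
  have "legendre_coeff h n * (1 - P * harm_rat m) * (fact n * fact m)\<^sup>2
      = (legendre_coeff h n * (fact n)\<^sup>2 * fact (h - n)) * (fact m * (1 - P * harm_rat m))"
    by (simp add: m power2_eq_square)
  also have "\<dots> = (- 1) ^ h * (fact (p - 1 - m) * (- 1) ^ m * fact m * (1 - P * harm_rat m))"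
    unfolding legendre_coeff_fact[OF m(3)] by (simp add: m sgn)
  also have "\<dots> \<approx> (- 1) ^ h * fact (p - 1)"
    using fact_reflect[OF m(1)] cong2_sym Zp_signed[of 1 h] by (intro cong2_mult_left) auto
  also have "\<dots> = signed_central * (fact h)\<^sup>2" by (simp only: signed_central_fact m)
  also have "\<dots> = (of_nat (h choose n))\<^sup>2 * signed_central * (fact n * fact m)\<^sup>2"
    using m by (simp add: binomial_fact power2_eq_square)
  finally show "legendre_coeff h n * (1 - P * harm_rat m) * (fact n * fact m)\<^sup>2
    \<approx> (of_nat (h choose n))\<^sup>2 * signed_central * (fact n * fact m)\<^sup>2" .
  show "(fact n * fact m)\<^sup>2 \<in> units" using m by (intro units_power units_mult units_fact)
  show "legendre_coeff h n * (1 - P * harm_rat m) \<in> Zp" "(of_nat (h choose n))\<^sup>2 * signed_central \<in> Zp"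
    using Zp_legendre_coeff Zp_signed_central Zp_harm m by auto
qed

text \<open>This is \<open>fact_reflect\<close> at the midpoint j = h, where p - 1 - j is h
  again.\<close>

lemma signed_central_cong_harm: "signed_central \<approx> 1 - P * harm_rat h"
proof (rule cong2_cancel)
  have m: "h < p" "p - 1 - h = h" "p - Suc h = h" "p - 1 = 2 * h" using p_eq by auto
  have "signed_central * (fact h)\<^sup>2 = (- 1) ^ h * fact (p - 1)" by (simp only: signed_central_fact m)
  also have "\<dots> \<approx> (- 1) ^ h * (fact h * (- 1) ^ h * fact h * (1 - P * harm_rat h))"
    using fact_reflect[OF m(1)] Zp_signed[of 1 h] by (intro cong2_mult_left) (auto simp: m)
  also have "\<dots> = (1 - P * harm_rat h) * (fact h)\<^sup>2" by (simp add: power2_eq_square)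
  finally show "signed_central * (fact h)\<^sup>2 \<approx> (1 - P * harm_rat h) * (fact h)\<^sup>2" .
  show "(fact h)\<^sup>2 \<in> units" using m by (intro units_power units_fact)
  show "signed_central \<in> Zp" "1 - P * harm_rat h \<in> Zp" using Zp_signed_central Zp_harm m by auto
qed

text \<open>A second evaluation, from the odd factors of (2h)!. Comparing it with
  \<open>signed_central_cong_harm\<close> will determine 4^h modulo p^2.\<close>

lemma signed_central_cong_power4: "signed_central \<approx> 4 ^ h * (1 - P * (harm_rat h / 2))"
proof (rule cong2_cancel)
  have m: "h < p" using p_eq by auto
  have H: "harm_rat h / 2 \<in> Zp" using Zp_harm m units_2 by (intro Zp_divide)
  \<comment> \<open>Reversing the order by j -> h + 1 - j writes each odd factor as p - 2j.\<close>
  have "(\<Prod>j=1..h. 2 * of_nat j - 1 :: rat) = (\<Prod>j=1..h. - (2 * of_nat j) + P * 1)"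
    by (rule prod.reindex_bij_witness[of _ "\<lambda>j. h + 1 - j" "\<lambda>j. h + 1 - j"]) (auto simp: P_eq)
  also have "\<dots> \<approx> (\<Prod>j=1..h. - (2 * of_nat j)) * (1 + P * (1 * (\<Sum>j=1..h. 1 / - (2 * of_nat j))))"
    using less_p by (intro cong2_prod_shift units_minus units_mult units_2 units_small) auto
  also have "(\<Prod>j=1..h. - (2 * of_nat j) :: rat) = (- 2) ^ h * fact h"
    by (induction h) (simp_all add: algebra_simps)
  also have "(\<Sum>j=1..h. 1 / - (2 * of_nat j) :: rat) = - (harm_rat h / 2)"
    by (simp add: harm_rat_def sum_negf sum_divide_distrib mult.commute)
  finally have *: "(\<Prod>j=1..h. 2 * of_nat j - 1) \<approx> (- 2) ^ h * fact h * (1 - P * (harm_rat h / 2))"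
    by simp
  have "signed_central * (fact h)\<^sup>2 = (- 1) ^ h * (2 ^ h * fact h) * (\<Prod>j=1..h. 2 * of_nat j - 1)"
    by (simp add: signed_central_fact fact_double)
  also have "\<dots> \<approx> (- 1) ^ h * (2 ^ h * fact h) * ((- 2) ^ h * fact h * (1 - P * (harm_rat h / 2)))"
    using m units_fact by (intro cong2_mult_left * Zp_signed Zp_mult Zp_power units_Zp[OF units_fact]) auto
  also have "\<dots> = ((- 1) * 2 * (- 2)) ^ h * (1 - P * (harm_rat h / 2)) * (fact h)\<^sup>2"
    unfolding power_mult_distrib by (simp only: power2_eq_square ac_simps)
  also have "((- 1) * 2 * (- 2)) = (4 :: rat)" by simp
  finally show "signed_central * (fact h)\<^sup>2 \<approx> 4 ^ h * (1 - P * (harm_rat h / 2)) * (fact h)\<^sup>2" .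
  show "(fact h)\<^sup>2 \<in> units" using m by (intro units_power units_fact)
  show "signed_central \<in> Zp" "4 ^ h * (1 - P * (harm_rat h / 2)) \<in> Zp"
    using Zp_signed_central H by (auto intro!: Zp_mult Zp_diff simp del: times_divide_eq_right)
qed

text \<open>This says H_h = -2 q_p(2) modulo p. With u = 1 - p H_h / 2, the two evaluations give 4^h
  u = 1 - p H_h = u^2 modulo p^2; cancelling the unit u leaves 2^(p-1) = 4^h = u.\<close>

lemma fermat_quotient_2_cong:
  "(fermat_quotient_2 p + harm_rat h / 2) / P \<in> Zp"
proof -
  have H: "harm_rat h / 2 \<in> Zp" using Zp_harm[of h] less_p units_2 by (intro Zp_divide) auto
  then have H': "- (harm_rat h / 2) \<in> Zp" by (rule Zp_minus)
  let ?u = "1 + P * (- (harm_rat h / 2))"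
  have "4 ^ h * ?u \<approx> signed_central" using cong2_sym[OF signed_central_cong_power4] by simp
  also have "signed_central \<approx> 1 + P * (- (harm_rat h / 2) + - (harm_rat h / 2))" using signed_central_cong_harm by simp
  also have "\<dots> \<approx> ?u * ?u" by (rule cong2_sym[OF cong2_linear[OF H' H']])
  finally have "4 ^ h \<approx> ?u"
    by (rule cong2_cancel[OF _ units_add_P[OF units_1 H'] _ Zp_add[OF _ Zp_mult[OF _ H']]]) auto
  then have "(4 ^ h - ?u) / P\<^sup>2 \<in> Zp" by (simp only: cong2_iff)
  moreover have "(2 :: rat) ^ (p - 1) = 4 ^ h" by (simp add: p_eq power_mult)
  ultimately show ?thesis
    by (simp add: fermat_quotient_2_def power2_eq_square field_simps)
qed

text \<open>Fermat's little theorem for base 2, read off from the preceding congruence.\<close>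

lemma Zp_fermat_quotient_2: "fermat_quotient_2 p \<in> Zp"
proof -
  have "P * ((fermat_quotient_2 p + harm_rat h / 2) / P) - harm_rat h / 2 \<in> Zp"
    using Zp_harm[of h] less_p units_2 fermat_quotient_2_cong by (intro Zp_diff Zp_mult Zp_divide[of "harm_rat h"]) auto
  then show ?thesis by simp
qed

text \<open>Morley's congruence modulo p^2, since 4^(p-1) = (1 + p q_p(2))^2; it results from
  replacing H_h by -2 q_p(2).\<close>

lemma signed_central_cong_fermat: "signed_central \<approx> 1 + P * (2 * fermat_quotient_2 p)"
proof -
  have "1 - P * harm_rat h \<approx> 1 + P * (2 * fermat_quotient_2 p)"
  proof (rule cong2_I)
    show "1 - P * harm_rat h - (1 + P * (2 * fermat_quotient_2 p))
        = P\<^sup>2 * (- 2 * ((fermat_quotient_2 p + harm_rat h / 2) / P))"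
      by (simp add: power2_eq_square field_simps)
    show "- 2 * ((fermat_quotient_2 p + harm_rat h / 2) / P) \<in> Zp"
      by (intro Zp_mult fermat_quotient_2_cong Zp_minus) auto
  qed (use Zp_harm[of h] less_p Zp_fermat_quotient_2 in auto)
  then show ?thesis using signed_central_cong_harm cong2_trans by blast
qed

section \<open>Truncation and first-order evaluation of the sum\<close>

abbreviation central_weight :: "nat \<Rightarrow> rat" where "central_weight k \<equiv> (of_nat ((2 * k) choose k))\<^sup>2 / 16 ^ k"

lemma Zp_central_weight: "central_weight k \<in> Zp"
  by (intro Zp_divide units_power units_16 Zp_power Zp_of_nat)

lemma units_shift:
  assumes "k < p" "n < p" "k \<noteq> n" "t \<in> Zp"
  shows "of_nat k + (t * P - of_nat n) \<in> units"
proof -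
  have "of_nat k - of_nat n + P * t \<in> units" using assms by (intro units_add_P units_diff)
  then show ?thesis by (simp add: algebra_simps)
qed

text \<open>Only at k = n does p divide the denominator; there it is \<open>t * P\<close>, and the
  quotient is 1/t.\<close>

lemma Zp_quotient:
  assumes "k < p" "n < p" "t \<in> units"
  shows "P / (of_nat k + (t * P - of_nat n)) \<in> Zp"
proof (cases "k = n")
  case True
  then have "P / (of_nat k + (t * P - of_nat n)) = 1 / t" by simp
  then show ?thesis using assms by (simp add: units_def)
next
  case False
  then show ?thesis using assms by (intro Zp_divide units_shift units_Zp[OF assms(3)]) auto
qed

text \<open>For h < k < p the prime divides (2k)! but not k!, hence divides (2k choose k). The
  square in the weight then supplies p^2, and the remaining factors are p-integral.\<close>

lemma truncated_sum_cong:
  assumes "n \<le> h" "t \<in> units"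
  shows "(\<Sum>k=0..p - 1. central_weight k * (P / (of_nat k + (t * P - of_nat n))))
    \<approx> (\<Sum>k=0..h. central_weight k * (P / (of_nat k + (t * P - of_nat n))))"
proof -
  define f where "f = (\<lambda>k. central_weight k * (P / (of_nat k + (t * P - of_nat n))))"
  have "f k \<approx> 0" if k: "k \<in> {h + 1..p - 1}" for k
  proof -
    have kp: "k < p" "p \<le> 2 * k" using k p_eq by auto
    have "fact k * fact k * ((2 * k) choose k) = (fact (2 * k) :: nat)"
      using binomial_fact_lemma[of k "2 * k"] by simp
    moreover have "p dvd fact (2 * k)" "\<not> p dvd fact k"
      using kp prime_dvd_fact_iff[OF prime_p] by auto
    ultimately have "p dvd ((2 * k) choose k)"
      using prime_dvd_mult_iff[OF prime_p] by metis
    then obtain d where d: "(2 * k) choose k = p * d" by blast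
    have 1: "f k - 0 = P\<^sup>2 * ((of_nat d)\<^sup>2 / 16 ^ k * (P / (of_nat k + (t * P - of_nat n))))"
      by (simp add: f_def d power_mult_distrib)
    have q: "P / (of_nat k + (t * P - of_nat n)) \<in> Zp"
      using kp assms less_p by (intro Zp_quotient) auto
    have 2: "f k \<in> Zp" unfolding f_def by (intro Zp_mult Zp_central_weight q)
    have 3: "(of_nat d)\<^sup>2 / 16 ^ k * (P / (of_nat k + (t * P - of_nat n))) \<in> Zp"
      by (intro Zp_mult Zp_divide units_power units_16 Zp_power Zp_of_nat q)
    show ?thesis using cong2_I[OF 1 2 _ 3] by simp
  qed
  then have "sum f {h + 1..p - 1} \<approx> (\<Sum>k\<in>{h + 1..p - 1}. 0)" by (rule cong2_sum)
  moreover have "sum f {0..h} \<in> Zp"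
    unfolding f_def using assms less_p by (intro Zp_sum Zp_mult Zp_central_weight Zp_quotient) auto
  ultimately have "sum f {0..h} + sum f {h + 1..p - 1} \<approx> sum f {0..h} + 0"
    by (intro cong2_add cong2_refl) auto
  moreover have "sum f {0..p - 1} = sum f {0..h} + sum f {h + 1..p - 1}"
    using sum.ub_add_nat[of 0 h f h] by (simp add: p_eq mult_2)
  ultimately show ?thesis by (simp add: f_def)
qed

lemma sum_recip_diff:
  assumes "n \<le> h"
  shows "(\<Sum>l\<in>{0..h} - {n}. 1 / (of_nat l - of_nat n)) = harm_rat (h - n) - harm_rat n"
proof -
  have split: "{0..h} - {n} = {0..<n} \<union> {n+1..h}" using assms by auto
  have "(\<Sum>l\<in>{0..h} - {n}. 1 / (of_nat l - of_nat n) :: rat)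
     = (\<Sum>l\<in>{0..<n}. 1 / (of_nat l - of_nat n)) + (\<Sum>l\<in>{n+1..h}. 1 / (of_nat l - of_nat n))"
    unfolding split by (rule sum.union_disjoint) auto
  also have "(\<Sum>l\<in>{0..<n}. 1 / (of_nat l - of_nat n) :: rat) = (\<Sum>l\<in>{1..n}. 1 / - of_nat l)"
    by (rule sum.reindex_bij_witness[of _ "\<lambda>i. n - i" "\<lambda>i. n - i"]) auto
  also have "(\<Sum>l\<in>{n+1..h}. 1 / (of_nat l - of_nat n) :: rat) = (\<Sum>l\<in>{1..h-n}. 1 / of_nat l)"
    by (rule sum.reindex_bij_witness[of _ "\<lambda>i. i + n" "\<lambda>i. i - n"]) auto
  finally show ?thesis by (simp add: harm_rat_def sum_negf)
qed

text \<open>The partial fraction identity at x = tp - n gives S t D = (-1)^h A, where D omits the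
  factor x + n = tp. Expanding A and D to first order and cancelling the unit tD leaves c_n / t with
  one correction factor.\<close>

lemma legendre_coeff_sum_cong:
  assumes n: "n \<le> h" and t: "t \<in> units"
  shows "(\<Sum>k=0..h. legendre_coeff h k * (P / (of_nat k + (t * P - of_nat n))))
    \<approx> legendre_coeff h n / t * (1 + P * (2 * t * (harm_rat n - harm_rat (h - n))))"
proof -
  let ?x = "t * P - of_nat n"
  define S where "S = (\<Sum>k=0..h. legendre_coeff h k * (P / (of_nat k + ?x)))"
  define A where "A = (\<Prod>j=1..h. - of_nat n - of_nat j + P * t)"
  define D where "D = (\<Prod>l\<in>{0..h} - {n}. of_nat l - of_nat n + P * t)"
  \<comment> \<open>\<open>A0\<close> and \<open>D0\<close> are the values of the products at t = 0;
    \<open>a\<close> and \<open>d\<close> are the reciprocal sums that govern their first-order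
    terms.\<close>
  define A0 where "A0 = (\<Prod>j=1..h. - of_nat n - of_nat j :: rat)"
  define D0 where "D0 = (\<Prod>l\<in>{0..h} - {n}. of_nat l - of_nat n :: rat)"
  define a where "a = (\<Sum>j=1..h. 1 / (- of_nat n - of_nat j) :: rat)"
  define d where "d = (\<Sum>l\<in>{0..h} - {n}. 1 / (of_nat l - of_nat n) :: rat)"
  have tZ: "t \<in> Zp" "t \<noteq> 0" using t by (auto simp: units_def)
  have np: "n < p" using n less_p by simp
  have uD: "of_nat l - of_nat n \<in> units" if "l \<in> {0..h} - {n}" for l
    using that n less_p by (intro units_diff) auto
  have uA: "- of_nat n - of_nat j \<in> units" if "j \<in> {1..h}" for j
  proof -
    have "- of_nat (n + j) \<in> units" using that n p_eq by (intro units_minus units_small) auto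
    moreover have "- of_nat n - of_nat j = (- of_nat (n + j) :: rat)" by simp
    ultimately show ?thesis by (simp only:)
  qed
  have uD': "D \<in> units" unfolding D_def by (intro units_prod units_add_P uD tZ)
  have aZ: "a \<in> Zp" unfolding a_def by (intro Zp_sum Zp_divide uA) auto
  have dZ: "d \<in> Zp" unfolding d_def by (intro Zp_sum Zp_divide uD) auto
  have D0Z: "D0 \<in> Zp" unfolding D0_def by (intro Zp_prod units_Zp uD)
  have RZ: "legendre_coeff h n / t * (1 + P * (t * (a - d))) \<in> Zp"
    using t tZ aZ dZ by (intro Zp_mult Zp_divide Zp_add Zp_diff Zp_legendre_coeff) auto
  have SZ: "S \<in> Zp" unfolding S_def using n t less_p
    by (intro Zp_sum Zp_mult Zp_legendre_coeff Zp_quotient) auto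
  have A: "A \<approx> A0 * (1 + P * (t * a))" unfolding A_def A0_def a_def
    using tZ uA by (intro cong2_prod_shift) auto
  have D: "D \<approx> D0 * (1 + P * (t * d))" unfolding D_def D0_def d_def
    using tZ uD by (intro cong2_prod_shift) auto
  have res: "legendre_coeff h n * D0 = (- 1) ^ h * A0" unfolding D0_def A0_def by (rule legendre_coeff_residue[OF n])

  have nz: "?x + of_nat k \<noteq> 0" if "k \<le> h" for k
  proof (cases "k = n")
    case False
    then show ?thesis
      using units_shift[of k n t] that less_p np tZ units_nz by (simp add: add.commute)
  qed (use tZ in simp)
  have "(\<Prod>k=0..h. ?x + of_nat k) = (?x + of_nat n) * (\<Prod>k\<in>{0..h} - {n}. ?x + of_nat k)"
    using n by (intro prod.remove) auto
  also have "(\<Prod>k\<in>{0..h} - {n}. ?x + of_nat k) = D"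
    unfolding D_def by (intro prod.cong) (auto simp: algebra_simps)
  finally have PD: "(\<Prod>k=0..h. ?x + of_nat k) = P * t * D" by simp
  have "S = P * (\<Sum>k=0..h. legendre_coeff h k / (?x + of_nat k))"
    unfolding S_def sum_distrib_left by (intro sum.cong) (auto simp: add.commute)
  \<comment> \<open>The numerator P of every summand is absorbed by the P in the omitted factor
    \<open>t * P\<close>.\<close>
  then have "S * (t * D) = (\<Sum>k=0..h. legendre_coeff h k / (?x + of_nat k)) * (P * t * D)"
    by simp
  also have "\<dots> = (- 1) ^ h * (\<Prod>j=1..h. ?x - of_nat j)"
    using legendre_coeff_partial_fractions[of h ?x] nz PD by simp
  also have "(\<Prod>j=1..h. ?x - of_nat j) = A"
    unfolding A_def by (intro prod.cong) (auto simp: algebra_simps)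
  also have "(- 1) ^ h * A \<approx> (- 1) ^ h * (A0 * (1 + P * (t * a)))"
    using Zp_signed[of 1 h] by (intro cong2_mult_left A) auto
  \<comment> \<open>By the residue identity the leading terms match. Splitting t a as t(a - d) + t d
    lets the second part rebuild \<open>D\<close>, which is then cancelled.\<close>
  also have "\<dots> = legendre_coeff h n * D0 * (1 + P * (t * (a - d) + t * d))"
    unfolding res by (simp add: algebra_simps)
  also have "\<dots> \<approx> legendre_coeff h n * D0 * ((1 + P * (t * (a - d))) * (1 + P * (t * d)))"
    using tZ aZ dZ D0Z Zp_legendre_coeff by (intro cong2_mult_left cong2_sym[OF cong2_linear]) auto
  also have "\<dots> = legendre_coeff h n * (1 + P * (t * (a - d))) * (D0 * (1 + P * (t * d)))"
    by (simp only: ac_simps)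
  also have "\<dots> \<approx> legendre_coeff h n * (1 + P * (t * (a - d))) * D"
    using tZ aZ dZ Zp_legendre_coeff by (intro cong2_mult_left cong2_sym[OF D]) auto
  also have "\<dots> = legendre_coeff h n / t * (1 + P * (t * (a - d))) * (t * D)"
    using tZ by simp
  finally have "S \<approx> legendre_coeff h n / t * (1 + P * (t * (a - d)))"
    by (rule cong2_cancel[OF _ units_mult[OF t uD'] SZ RZ])
  \<comment> \<open>Here a - d = 2 H_n - H_(h+n) - H_(h-n). Because it carries a factor P, H_(h+n)
    may be replaced by H_(h-n), to which it is congruent modulo p.\<close>
  also have "1 + P * (t * (a - d)) \<approx> 1 + P * (2 * t * (harm_rat n - harm_rat (h - n)))"
  proof (rule cong2_I)
    have a: "a = - (harm_rat (h + n) - harm_rat n)"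
    proof -
      have "a = - (\<Sum>j=1..h. 1 / of_nat (n + j))"
        unfolding a_def sum_negf[symmetric]
        by (intro sum.cong refl) (simp add: minus_divide_right)
      then show ?thesis using harm_rat_diff[of n h] by (simp add: add.commute)
    qed
    have d: "d = harm_rat (h - n) - harm_rat n"
      unfolding d_def by (rule sum_recip_diff[OF n])
    have "P\<^sup>2 * (- t * (u / P)) = - t * P * u" for u
      by (simp add: power2_eq_square)
    then show "1 + P * (t * (a - d)) - (1 + P * (2 * t * (harm_rat n - harm_rat (h - n))))
       = P\<^sup>2 * (- t * ((harm_rat (h + n) - harm_rat (h - n)) / P))"
      unfolding a d by (simp only:) (simp add: algebra_simps)
    show "- t * ((harm_rat (h + n) - harm_rat (h - n)) / P) \<in> Zp"
      using tZ by (intro Zp_mult Zp_minus harm_reflect[OF n])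
    show "1 + P * (t * (a - d)) \<in> Zp"
      using tZ aZ dZ by (intro Zp_add Zp_mult Zp_diff) auto
    show "1 + P * (2 * t * (harm_rat n - harm_rat (h - n))) \<in> Zp"
      using tZ n less_p by (intro Zp_add Zp_mult Zp_diff Zp_harm) auto
  qed
  then have "legendre_coeff h n / t * (1 + P * (t * (a - d)))
     \<approx> legendre_coeff h n / t * (1 + P * (2 * t * (harm_rat n - harm_rat (h - n))))"
    using t Zp_legendre_coeff by (intro cong2_mult_left Zp_divide)
  finally show ?thesis by (simp add: S_def)
qed

section \<open>The other closed forms and the chain of congruences\<close>

text \<open>By symmetry of h choose n, \<open>legendre_coeff_cong_signed_central\<close> at n and at
  m has the same right side. So c_m (1 - p H_n) and c_n (1 - p H_m) agree, and the unit 1 - p H_n is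
  divided out.\<close>

lemma legendre_coeff_cong_swap:
  assumes "n + m = h"
  shows "legendre_coeff h m \<approx> legendre_coeff h n * (1 + P * (harm_rat n - harm_rat m))"
proof (rule cong2_cancel)
  have lt: "n < p" "m < p" using assms less_p by auto
  have eq: "(h choose n) = (h choose m)" "m + n = h" using binomial_symmetric[of n h] assms by auto
  then have "legendre_coeff h m * (1 - P * harm_rat n) \<approx> legendre_coeff h n * (1 - P * harm_rat m)"
    using cong2_trans[OF legendre_coeff_cong_signed_central[OF eq(2), folded eq(1)]
      cong2_sym[OF legendre_coeff_cong_signed_central[OF assms]]] by simp
  also have "\<dots> = legendre_coeff h n * (1 + P * ((harm_rat n - harm_rat m) + - harm_rat n))"
    by simp
  also have "\<dots> \<approx> legendre_coeff h n * ((1 + P * (harm_rat n - harm_rat m)) * (1 + P * - harm_rat n))"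
    using lt by (intro cong2_mult_left cong2_sym[OF cong2_linear] Zp_legendre_coeff Zp_diff Zp_minus Zp_harm)
  finally show "legendre_coeff h m * (1 - P * harm_rat n)
     \<approx> legendre_coeff h n * (1 + P * (harm_rat n - harm_rat m)) * (1 - P * harm_rat n)"
    by (simp add: mult.assoc)
  show "1 - P * harm_rat n \<in> units"
    using units_add_P[OF units_1 Zp_minus[OF Zp_harm[OF lt(1)]]] by simp
  show "legendre_coeff h n * (1 + P * (harm_rat n - harm_rat m)) \<in> Zp"
    using lt by (intro Zp_mult Zp_add Zp_diff Zp_harm Zp_legendre_coeff) auto
qed (rule Zp_legendre_coeff)

text \<open>Insert the Fermat quotient form of \<open>signed_central\<close> into
  \<open>legendre_coeff_cong_signed_central\<close> and divide by the unit 1 - p H_m.\<close>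

lemma legendre_coeff_cong_binomial:
  assumes "n + m = h"
  shows "legendre_coeff h n \<approx> (of_nat (h choose n))\<^sup>2 * (1 + P * (2 * fermat_quotient_2 p + harm_rat m))"
proof (rule cong2_cancel)
  let ?q = "2 * fermat_quotient_2 p"
  have lt: "m < p" using assms less_p by auto
  have q: "?q \<in> Zp" using Zp_fermat_quotient_2 by auto
  have "legendre_coeff h n * (1 - P * harm_rat m) \<approx> (of_nat (h choose n))\<^sup>2 * signed_central"
    by (rule legendre_coeff_cong_signed_central[OF assms])
  also have "\<dots> \<approx> (of_nat (h choose n))\<^sup>2 * (1 + P * ((?q + harm_rat m) + - harm_rat m))"
    using signed_central_cong_fermat by (simp add: cong2_mult_left)
  also have "\<dots> \<approx> (of_nat (h choose n))\<^sup>2 * ((1 + P * (?q + harm_rat m)) * (1 + P * - harm_rat m))"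
    using lt by (intro cong2_mult_left cong2_sym[OF cong2_linear] Zp_power Zp_of_nat Zp_add Zp_minus Zp_harm q)
  finally show "legendre_coeff h n * (1 - P * harm_rat m)
     \<approx> (of_nat (h choose n))\<^sup>2 * (1 + P * (?q + harm_rat m)) * (1 - P * harm_rat m)"
    by (simp add: mult.assoc)
  show "1 - P * harm_rat m \<in> units"
    using units_add_P[OF units_1 Zp_minus[OF Zp_harm[OF lt(1)]]] by simp
  show "(of_nat (h choose n))\<^sup>2 * (1 + P * (?q + harm_rat m)) \<in> Zp"
    using lt Zp_fermat_quotient_2 by (intro Zp_mult Zp_add Zp_harm) auto
qed (rule Zp_legendre_coeff)

text \<open>Carries a first-order relation between X and Y over to the shape of the closed forms;
  each of the three is compared with a common value through it.\<close>

lemma cong2_combine: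
  assumes "X \<approx> Y * (1 + P * u)" "t \<in> units" "Y \<in> Zp" "u \<in> Zp" "v \<in> Zp"
  shows "X / t * (1 + P * v) \<approx> Y / t * (1 + P * (u + v))"
proof -
  have tZ: "1 / t \<in> Zp" using assms by (simp add: units_def)
  have "X / t * (1 + P * v) = X * (1 / t * (1 + P * v))" by simp
  also have "\<dots> \<approx> Y * (1 + P * u) * (1 / t * (1 + P * v))"
    using assms tZ by (intro cong2_mult_right Zp_mult[OF tZ]) auto
  also have "\<dots> = Y * (1 / t) * ((1 + P * u) * (1 + P * v))" by simp
  also have "\<dots> \<approx> Y * (1 / t) * (1 + P * (u + v))"
    using assms by (intro cong2_mult_left cong2_linear Zp_mult[OF _ tZ])
  finally show ?thesis by simp
qed

text \<open>In terms of t = s + 1 and b = tp - n, every closed form is a rewriting of the single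
  value \<open>E\<close> built on c_n: \<open>E3\<close> replaces c_n by its weight,
  \<open>E1\<close> passes to m by the swap, and \<open>E2\<close> uses the binomial form.\<close>

lemma congruence_chain:
  assumes nm: "n + m = h" and t: "t \<in> units"
  defines "x \<equiv> t * P - of_nat n"
  defines "S1 \<equiv> (\<Sum>k=0..p - 1. central_weight k * (P / (of_nat k + x)))"
    and "S2 \<equiv> (\<Sum>k=0..h. central_weight k * (P / (of_nat k + x)))"
    and "E1 \<equiv> central_weight m / t * (1 + P * ((2 * t - 1) * (harm_rat n - harm_rat m)))"
    and "E2 \<equiv> (of_nat (h choose n))\<^sup>2 / t * (1 + P * (2 * fermat_quotient_2 p
                + 2 * t * harm_rat n - (2 * t - 1) * harm_rat m))"
    and "E3 \<equiv> central_weight n / t * (1 + P * (2 * t * (harm_rat n - harm_rat m)))"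
  shows "S1 \<approx> S2 \<and> S2 \<approx> E1 \<and> E1 \<approx> E2 \<and> E2 \<approx> E3"
proof -
  have n: "n \<le> h" "m \<le> h" "h - n = m" using nm by auto
  have tZ: "t \<in> Zp" "1 / t \<in> Zp" using t by (auto simp: units_def)
  have HZ: "harm_rat n \<in> Zp" "harm_rat m \<in> Zp" using n less_p by (auto intro!: Zp_harm)
  have vZ: "2 * t * (harm_rat n - harm_rat m) \<in> Zp" "(2 * t - 1) * (harm_rat n - harm_rat m) \<in> Zp"
    using tZ HZ by auto
  define E where "E = legendre_coeff h n / t * (1 + P * (2 * t * (harm_rat n - harm_rat m)))"
  have weight_cong: "central_weight k \<approx> legendre_coeff h k" if "k \<le> h" for k
    using central_binomial_cong_legendre_coeff that by blast
  have S12: "S1 \<approx> S2" unfolding S1_def S2_def x_def by (rule truncated_sum_cong[OF n(1) t])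
  have "S2 \<approx> (\<Sum>k=0..h. legendre_coeff h k * (P / (of_nat k + x)))" unfolding S2_def x_def
    using n t less_p by (intro cong2_sum cong2_mult_right weight_cong Zp_quotient) auto
  also have "\<dots> \<approx> E" using legendre_coeff_sum_cong[OF n(1) t] by (simp add: E_def x_def n)
  finally have S2: "S2 \<approx> E" .
  have "central_weight n \<approx> legendre_coeff h n * (1 + P * 0)" using weight_cong n by simp
  from cong2_combine[OF this t Zp_legendre_coeff _ vZ(1)] have E3: "E3 \<approx> E"
    by (simp add: E3_def E_def)
  have "central_weight m \<approx> legendre_coeff h n * (1 + P * (harm_rat n - harm_rat m))"
    using cong2_trans[OF weight_cong legendre_coeff_cong_swap] n nm by blast
  from cong2_combine[OF this t Zp_legendre_coeff _ vZ(2)] have E1: "E1 \<approx> E"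
    using HZ by (simp add: E1_def E_def algebra_simps)
  have "E \<approx> E2"
    using cong2_combine[OF legendre_coeff_cong_binomial[OF nm] t _ _ vZ(1)] HZ Zp_fermat_quotient_2
    by (simp add: E2_def E_def algebra_simps)
  then show ?thesis using S12 S2 E3 E1 cong2_sym cong2_trans by meson
qed

end

theorem theorem4p1:
  fixes p r :: nat and b s :: rat
  assumes "prime p" and "odd p"
    and "b \<in> p_integral p"
    and "r = least_residue p b"
    and "(of_nat r :: rat) > of_nat p / 2"
    and "s = (b - of_nat r) / of_nat p"
    and "\<not> p_cong p (of_nat p) s (- 1)"
  shows
    "let m = r - (p + 1) div 2;
         n = p - r;
         P = (of_nat p :: rat);
         S1 = (\<Sum>k=0..p - 1. (of_nat ((2 * k) choose k))\<^sup>2 / 16 ^ k * (P / (of_nat k + b)));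
         S2 = (\<Sum>k=0..(p - 1) div 2. (of_nat ((2 * k) choose k))\<^sup>2 / 16 ^ k * (P / (of_nat k + b)));
         E1 = (of_nat ((2 * m) choose m))\<^sup>2 / ((s + 1) * 16 ^ m)
                * (1 + P * (2 * s + 1) * (harm_rat n - harm_rat m));
         E2 = 1 / (s + 1) * (of_nat (((p - 1) div 2) choose n))\<^sup>2
                * (1 + P * (2 * fermat_quotient_2 p + (2 * s + 2) * harm_rat n
                              - (2 * s + 1) * harm_rat m));
         E3 = (of_nat ((2 * n) choose n))\<^sup>2 / ((s + 1) * 16 ^ n)
                * (1 + P * (2 * s + 2) * (harm_rat n - harm_rat m))
     in p_cong p (P\<^sup>2) S1 S2 \<and> p_cong p (P\<^sup>2) S2 E1
        \<and> p_cong p (P\<^sup>2) E1 E2 \<and> p_cong p (P\<^sup>2) E2 E3"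
proof -
  define h where "h = (p - 1) div 2"
  have p: "p = 2 * h + 1" using \<open>odd p\<close> unfolding h_def by (elim oddE) simp
  interpret odd_prime p h by unfold_locales (use \<open>prime p\<close> p in auto)
  have "r < p \<and> p_cong p P b (of_nat r)"
    unfolding \<open>r = least_residue p b\<close> least_residue_def
    using least_residue_unique[OF \<open>prime p\<close> \<open>b \<in> p_integral p\<close>] by (rule theI')
  then have r: "r < p" and sZ: "s \<in> Zp"
    using \<open>s = _\<close> p_cong_iff[of P p b "of_nat r"] by auto
  have "(of_nat (2 * r) :: rat) > of_nat p" using \<open>of_nat r > _\<close> by simp
  then have r2: "2 * r > p" by (simp only: of_nat_less_iff)
  define n m where "n = p - r" and "m = r - (p + 1) div 2"
  \<comment> \<open>Both subtractions are exact: r < p, and 2r > p forces r to be at least (p +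
    1)/2.\<close>
  have nm: "n + m = h" using r r2 p by (simp add: n_def m_def)
  define t where "t = s + 1"
  \<comment> \<open>Failure of s = -1 modulo p means that p does not divide t = s + 1.\<close>
  have "t \<in> units"
    using \<open>\<not> p_cong p P s (- 1)\<close> sZ p_cong_iff[of P p s "- 1"] Zp_minus[of 1]
    by (auto simp: units_iff t_def)
  \<comment> \<open>Since b = sp + r, replacing s by t - 1 and r by p - n cancels the two copies of
    p.\<close>
  moreover have b: "b = t * P - of_nat n"
    using \<open>s = _\<close> r by (simp add: t_def n_def field_simps)
  ultimately show ?thesis
    using congruence_chain[OF nm, of t]
    unfolding Let_def n_def[symmetric] m_def[symmetric] h_def[symmetric] b
    by (simp add: t_def algebra_simps)
qed

end
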